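(* (Subject reduction.) In the $\mathcal{L}^{\mathcal S}_2$-calculus described in the context, if $\Xi;\Gamma\vdash t:A$ is derivable and $t\to u$, then $\Xi;\Gamma\vdash u:A$ is derivable.
   Context: Let $\mathcal S$ be a semiring. Propositions (modulo $\alpha$-equivalence; $X$ ranges over proposition variables): $A ::= X \mid \mathbf 1 \mid A\multimap A\mid A\otimes A\mid \top\mid \mathbf 0\mid A\,\&\,A\mid A\oplus A\mid\, !A\mid \forall X.A$. $(B/X)A$ is capture-avoiding substitution and $FV$ denotes free proposition variables. Proof-terms (modulo $\alpha$-equivalence; $a\in\mathcal S$): $t ::= x \mid t\boxplus u\mid a\bullet t\mid a.\star\mid \delta_{\mathbf 1}(t,u)\mid \lambda x^A.t\mid t\,u\mid t\otimes u\mid \delta_\otimes(t,x^Ay^B.u)\mid\langle\rangle\mid \delta_{\mathbf 0}(t) \mid \langle t,u\rangle\mid \delta^1_\&(t,x^A.u)\mid\delta^2_\&(t,x^B.u)\mid \mathrm{inl}(t)\mid\mathrm{inr}(t)\mid\delta_\oplus(t,x^A.u,y^B.v)\mid\, !t\mid\delta_!(t,x^A.u)\mid\Lambda X.t\mid t\,A$; here $\boxplus$ is the proof-term sum and $\bullet$ scalar product. $(u/x)t$ and $(B/X)t$ denote substitutions. Sequents are $\Xi;\Gamma\vdash t:A$ where $\Xi$ (non-linear) and $\Gamma$ (linear) are finite sets of declarations $x^B$, and $\Gamma,\Delta$ denotes a disjoint union. Typing rules: $\Xi;x^A\vdash x:A$; $\Xi,x^A;\varnothing\vdash x:A$; from $\Xi;\Gamma\vdash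 t:A$ and $\Xi;\Gamma\vdash u:A$ infer $\Xi;\Gamma\vdash t\boxplus u:A$; from $\Xi;\Gamma\vdash t:A$ infer $\Xi;\Gamma\vdash a\bullet t:A$; $\Xi;\varnothing\vdash a.\star:\mathbf 1$; from $\Xi;\Gamma\vdash t:\mathbf 1$ and $\Xi;\Delta\vdash u:A$ infer $\Xi;\Gamma,\Delta\vdash \delta_{\mathbf 1}(t,u):A$; from $\Xi;\Gamma,x^A\vdash t:B$ infer $\Xi;\Gamma\vdash \lambda x^A.t:A\multimap B$; from $\Xi;\Gamma\vdash t:A\multimap B$ and $\Xi;\Delta\vdash u:A$ infer $\Xi;\Gamma,\Delta\vdash t\,u:B$; from $\Xi;\Gamma\vdash t:A$ and $\Xi;\Delta\vdash u:B$ infer $\Xi;\Gamma,\Delta\vdash t\otimes u:A\otimes B$; from $\Xi;\Gamma\vdash t:A\otimes B$ and $\Xi;\Delta,x^A,y^B\vdash u:C$ infer $\Xi;\Gamma,\Delta\vdash\delta_\otimes(t,x^Ay^B.u):C$; $\Xi;\Gamma\vdash\langle\rangle:\top$ for any $\Gamma$; from $\Xi;\Gamma\vdash t:\mathbf 0$ infer $\Xi;\Gamma,\Delta\vdash\delta_{\mathbf 0}(t):C$; from $\Xi;\Gamma\vdash t:A$ and $\Xi;\Gamma\vdash u:B$ infer $\Xi;\Gamma\vdash\langle t,u\rangle:A\&B$; from $\Xi;\Gamma\vdash t:A\&B$ and $\Xi;\Delta,x^A\vdash u:C$ infer $\Xi;\Gamma,\Delta\vdash\delta^1_\&(t,x^A.u):C$;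 from $\Xi;\Gamma\vdash t:A\&B$ and $\Xi;\Delta,x^B\vdash u:C$ infer $\Xi;\Gamma,\Delta\vdash\delta^2_\&(t,x^B.u):C$; from $\Xi;\Gamma\vdash t:A$ infer $\Xi;\Gamma\vdash\mathrm{inl}(t):A\oplus B$; from $\Xi;\Gamma\vdash t:B$ infer $\Xi;\Gamma\vdash\mathrm{inr}(t):A\oplus B$; from $\Xi;\Gamma\vdash t:A\oplus B$, $\Xi;\Delta,x^A\vdash u:C$ and $\Xi;\Delta,y^B\vdash v:C$ infer $\Xi;\Gamma,\Delta\vdash\delta_\oplus(t,x^A.u,y^B.v):C$; from $\Xi;\varnothing\vdash t:A$ infer $\Xi;\varnothing\vdash\, !t:\,!A$; from $\Xi;\Gamma\vdash t:\,!A$ and $\Xi,x^A;\Delta\vdash u:B$ infer $\Xi;\Gamma,\Delta\vdash\delta_!(t,x^A.u):B$; from $\Xi;\Gamma\vdash t:A$ with $X\notin FV(\Xi,\Gamma)$ infer $\Xi;\Gamma\vdash\Lambda X.t:\forall X.A$; from $\Xi;\Gamma\vdash t:\forall X.B$ infer $\Xi;\Gamma\vdash t\,A:(A/X)B$. One-step reduction $\to$ is the closure under arbitrary proof-term contexts of the rules: $\delta_{\mathbf 1}(a.\star,t)\to a\bullet t$; $(\lambda x^A.t)\,u\to(u/x)t$; $\delta_\otimes(u\otimes v,x^Ay^B.w)\to(u/x,v/y)w$; $\delta^i_\&(\langle t_1,t_2\rangle,x.v)\to(t_i/x)v$ for $i=1,2$; $\delta_\oplus(\mathrm{inl}(t),x^A.v,y^B.w)\to(t/x)v$;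 $\delta_\oplus(\mathrm{inr}(u),x^A.v,y^B.w)\to(u/y)w$; $\delta_!(!t,x^A.u)\to(t/x)u$; $(\Lambda X.t)\,A\to(A/X)t$; $a.\star\boxplus b.\star\to(a+b).\star$; $(\lambda x^A.t)\boxplus(\lambda x^A.u)\to\lambda x^A.(t\boxplus u)$; $\delta_\otimes(t\boxplus u,x^Ay^B.v)\to\delta_\otimes(t,x^Ay^B.v)\boxplus\delta_\otimes(u,x^Ay^B.v)$; $\langle\rangle\boxplus\langle\rangle\to\langle\rangle$; $\langle t,u\rangle\boxplus\langle v,w\rangle\to\langle t\boxplus v,u\boxplus w\rangle$; $\delta_\oplus(t\boxplus u,x^A.v,y^B.w)\to\delta_\oplus(t,x^A.v,y^B.w)\boxplus\delta_\oplus(u,x^A.v,y^B.w)$; $!t\boxplus !u\to !(t\boxplus u)$; $(\Lambda X.t)\boxplus(\Lambda X.u)\to\Lambda X.(t\boxplus u)$; $a\bullet b.\star\to(a\times b).\star$; $a\bullet\lambda x^A.t\to\lambda x^A.a\bullet t$; $\delta_\otimes(a\bullet t,x^Ay^B.v)\to a\bullet\delta_\otimes(t,x^Ay^B.v)$; $a\bullet\langle\rangle\to\langle\rangle$; $a\bullet\langle t,u\rangle\to\langle a\bullet t,a\bullet u\rangle$; $\delta_\oplus(a\bullet t,x^A.v,y^B.w)\to a\bullet\delta_\oplus(t,x^A.v,y^B.w)$; $a\bullet !t\to !(a\bullet t)$; $a\bullet\Lambda X.t\to\Lambda X.a\bullet t$. *)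

theory Defs
  imports Main
begin

text \<open>
  Propositions and proof-terms modulo \<open>\<alpha>\<close>-equivalence are represented by de Bruijn indices,
  with two independent index spaces: one for proposition variables (bound by \<open>Forall\<close> and
  \<open>TLam\<close>), one for term variables.  An index pointing beyond all enclosing binders is a free
  variable, so every element of the datatypes below is a legitimate expression.
\<close>

datatype lprop =
    PVar nat
  | One
  | Lolli lprop lprop  (infixr \<open>\<multimap>\<close> 65)
  | Tensor lprop lprop  (infixr \<open>\<otimes>\<close> 70)
  | Top
  | Zero
  | With lprop lprop  (infixr \<open>\<sqinter>\<close> 70)
  | Plus lprop lprop  (infixr \<open>\<oplus>\<close> 70)
  | OfCourse lprop
  | Forall lprop

text \<open>
  \<open>plift c A\<close> renames the variables \<open>i \<ge> c\<close> of \<open>A\<close> to \<open>i + 1\<close>.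
  \<open>psubst k B A\<close> substitutes \<open>B\<close> for the variable \<open>k\<close> in \<open>A\<close>, which is thereby removed: the
  variables above \<open>k\<close> move down by one.  Lifting \<open>B\<close> under a binder is what avoids capture.
\<close>

primrec plift :: "nat \<Rightarrow> lprop \<Rightarrow> lprop" where
  "plift c (PVar i) = (if i < c then PVar i else PVar (Suc i))"
| "plift c One = One"
| "plift c (A \<multimap> B) = (plift c A \<multimap> plift c B)"
| "plift c (A \<otimes> B) = (plift c A \<otimes> plift c B)"
| "plift c Top = Top"
| "plift c Zero = Zero"
| "plift c (A \<sqinter> B) = (plift c A \<sqinter> plift c B)"
| "plift c (A \<oplus> B) = (plift c A \<oplus> plift c B)"
| "plift c (OfCourse A) = OfCourse (plift c A)"
| "plift c (Forall A) = Forall (plift (Suc c) A)"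

primrec psubst :: "nat \<Rightarrow> lprop \<Rightarrow> lprop \<Rightarrow> lprop" where
  "psubst k C (PVar i) = (if i < k then PVar i else if i = k then C else PVar (i - 1))"
| "psubst k C One = One"
| "psubst k C (A \<multimap> B) = (psubst k C A \<multimap> psubst k C B)"
| "psubst k C (A \<otimes> B) = (psubst k C A \<otimes> psubst k C B)"
| "psubst k C Top = Top"
| "psubst k C Zero = Zero"
| "psubst k C (A \<sqinter> B) = (psubst k C A \<sqinter> psubst k C B)"
| "psubst k C (A \<oplus> B) = (psubst k C A \<oplus> psubst k C B)"
| "psubst k C (OfCourse A) = OfCourse (psubst k C A)"
| "psubst k C (Forall A) = Forall (psubst (Suc k) (plift 0 C) A)"

text \<open>
  Each proposition argument annotates a variable bound in the term argument that follows it
  (except in \<open>TApp\<close>).  In \<open>ElimTensor t A B u\<close>, standing for \<open>\<delta>\<^sub>\<otimes>(t, x\<^sup>A y\<^sup>B. u)\<close>, the variable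
  \<open>y\<close> is bound innermost: in \<open>u\<close>, index \<open>0\<close> is \<open>y\<close> and index \<open>1\<close> is \<open>x\<close>.
\<close>

datatype 's trm =
    Var nat
  | Sum "'s trm" "'s trm"  (infixl \<open>\<boxplus>\<close> 65)
  | Scal 's "'s trm"  (infixr \<open>\<bullet>\<close> 75)
  | Star 's
  | ElimOne "'s trm" "'s trm"
  | Lam lprop "'s trm"
  | App "'s trm" "'s trm"
  | Tens "'s trm" "'s trm"
  | ElimTensor "'s trm" lprop lprop "'s trm"
  | Unit
  | ElimZero "'s trm"
  | Pair "'s trm" "'s trm"
  | ElimWith1 "'s trm" lprop "'s trm"
  | ElimWith2 "'s trm" lprop "'s trm"
  | Inl "'s trm"
  | Inr "'s trm"
  | ElimPlus "'s trm" lprop "'s trm" lprop "'s trm"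
  | Bang "'s trm"
  | ElimBang "'s trm" lprop "'s trm"
  | TLam "'s trm"
  | TApp "'s trm" lprop

text \<open>Lifting and substitution of proposition variables in proof-terms.\<close>

primrec tlift :: "nat \<Rightarrow> 's trm \<Rightarrow> 's trm" where
  "tlift c (Var i) = Var i"
| "tlift c (t \<boxplus> u) = tlift c t \<boxplus> tlift c u"
| "tlift c (a \<bullet> t) = a \<bullet> tlift c t"
| "tlift c (Star a) = Star a"
| "tlift c (ElimOne t u) = ElimOne (tlift c t) (tlift c u)"
| "tlift c (Lam A t) = Lam (plift c A) (tlift c t)"
| "tlift c (App t u) = App (tlift c t) (tlift c u)"
| "tlift c (Tens t u) = Tens (tlift c t) (tlift c u)"
| "tlift c (ElimTensor t A B u) = ElimTensor (tlift c t) (plift c A) (plift c B) (tlift c u)"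
| "tlift c Unit = Unit"
| "tlift c (ElimZero t) = ElimZero (tlift c t)"
| "tlift c (Pair t u) = Pair (tlift c t) (tlift c u)"
| "tlift c (ElimWith1 t A u) = ElimWith1 (tlift c t) (plift c A) (tlift c u)"
| "tlift c (ElimWith2 t B u) = ElimWith2 (tlift c t) (plift c B) (tlift c u)"
| "tlift c (Inl t) = Inl (tlift c t)"
| "tlift c (Inr t) = Inr (tlift c t)"
| "tlift c (ElimPlus t A u B v) =
     ElimPlus (tlift c t) (plift c A) (tlift c u) (plift c B) (tlift c v)"
| "tlift c (Bang t) = Bang (tlift c t)"
| "tlift c (ElimBang t A u) = ElimBang (tlift c t) (plift c A) (tlift c u)"
| "tlift c (TLam t) = TLam (tlift (Suc c) t)"
| "tlift c (TApp t A) = TApp (tlift c t) (plift c A)"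

primrec tsubst :: "nat \<Rightarrow> lprop \<Rightarrow> 's trm \<Rightarrow> 's trm" where
  "tsubst k C (Var i) = Var i"
| "tsubst k C (t \<boxplus> u) = tsubst k C t \<boxplus> tsubst k C u"
| "tsubst k C (a \<bullet> t) = a \<bullet> tsubst k C t"
| "tsubst k C (Star a) = Star a"
| "tsubst k C (ElimOne t u) = ElimOne (tsubst k C t) (tsubst k C u)"
| "tsubst k C (Lam A t) = Lam (psubst k C A) (tsubst k C t)"
| "tsubst k C (App t u) = App (tsubst k C t) (tsubst k C u)"
| "tsubst k C (Tens t u) = Tens (tsubst k C t) (tsubst k C u)"
| "tsubst k C (ElimTensor t A B u) =
     ElimTensor (tsubst k C t) (psubst k C A) (psubst k C B) (tsubst k C u)"
| "tsubst k C Unit = Unit"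
| "tsubst k C (ElimZero t) = ElimZero (tsubst k C t)"
| "tsubst k C (Pair t u) = Pair (tsubst k C t) (tsubst k C u)"
| "tsubst k C (ElimWith1 t A u) = ElimWith1 (tsubst k C t) (psubst k C A) (tsubst k C u)"
| "tsubst k C (ElimWith2 t B u) = ElimWith2 (tsubst k C t) (psubst k C B) (tsubst k C u)"
| "tsubst k C (Inl t) = Inl (tsubst k C t)"
| "tsubst k C (Inr t) = Inr (tsubst k C t)"
| "tsubst k C (ElimPlus t A u B v) =
     ElimPlus (tsubst k C t) (psubst k C A) (tsubst k C u) (psubst k C B) (tsubst k C v)"
| "tsubst k C (Bang t) = Bang (tsubst k C t)"
| "tsubst k C (ElimBang t A u) = ElimBang (tsubst k C t) (psubst k C A) (tsubst k C u)"
| "tsubst k C (TLam t) = TLam (tsubst (Suc k) (plift 0 C) t)"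
| "tsubst k C (TApp t A) = TApp (tsubst k C t) (psubst k C A)"

text \<open>Lifting and substitution of term variables.\<close>

primrec lift :: "nat \<Rightarrow> 's trm \<Rightarrow> 's trm" where
  "lift c (Var i) = (if i < c then Var i else Var (Suc i))"
| "lift c (t \<boxplus> u) = lift c t \<boxplus> lift c u"
| "lift c (a \<bullet> t) = a \<bullet> lift c t"
| "lift c (Star a) = Star a"
| "lift c (ElimOne t u) = ElimOne (lift c t) (lift c u)"
| "lift c (Lam A t) = Lam A (lift (Suc c) t)"
| "lift c (App t u) = App (lift c t) (lift c u)"
| "lift c (Tens t u) = Tens (lift c t) (lift c u)"
| "lift c (ElimTensor t A B u) = ElimTensor (lift c t) A B (lift (Suc (Suc c)) u)"
| "lift c Unit = Unit"
| "lift c (ElimZero t) = ElimZero (lift c t)"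
| "lift c (Pair t u) = Pair (lift c t) (lift c u)"
| "lift c (ElimWith1 t A u) = ElimWith1 (lift c t) A (lift (Suc c) u)"
| "lift c (ElimWith2 t B u) = ElimWith2 (lift c t) B (lift (Suc c) u)"
| "lift c (Inl t) = Inl (lift c t)"
| "lift c (Inr t) = Inr (lift c t)"
| "lift c (ElimPlus t A u B v) = ElimPlus (lift c t) A (lift (Suc c) u) B (lift (Suc c) v)"
| "lift c (Bang t) = Bang (lift c t)"
| "lift c (ElimBang t A u) = ElimBang (lift c t) A (lift (Suc c) u)"
| "lift c (TLam t) = TLam (lift c t)"
| "lift c (TApp t A) = TApp (lift c t) A"

primrec subst :: "nat \<Rightarrow> 's trm \<Rightarrow> 's trm \<Rightarrow> 's trm" where
  "subst k s (Var i) = (if i < k then Var i else if i = k then s else Var (i - 1))"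
| "subst k s (t \<boxplus> u) = subst k s t \<boxplus> subst k s u"
| "subst k s (a \<bullet> t) = a \<bullet> subst k s t"
| "subst k s (Star a) = Star a"
| "subst k s (ElimOne t u) = ElimOne (subst k s t) (subst k s u)"
| "subst k s (Lam A t) = Lam A (subst (Suc k) (lift 0 s) t)"
| "subst k s (App t u) = App (subst k s t) (subst k s u)"
| "subst k s (Tens t u) = Tens (subst k s t) (subst k s u)"
| "subst k s (ElimTensor t A B u) =
     ElimTensor (subst k s t) A B (subst (Suc (Suc k)) (lift 0 (lift 0 s)) u)"
| "subst k s Unit = Unit"
| "subst k s (ElimZero t) = ElimZero (subst k s t)"
| "subst k s (Pair t u) = Pair (subst k s t) (subst k s u)"
| "subst k s (ElimWith1 t A u) = ElimWith1 (subst k s t) A (subst (Suc k) (lift 0 s) u)"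
| "subst k s (ElimWith2 t B u) = ElimWith2 (subst k s t) B (subst (Suc k) (lift 0 s) u)"
| "subst k s (Inl t) = Inl (subst k s t)"
| "subst k s (Inr t) = Inr (subst k s t)"
| "subst k s (ElimPlus t A u B v) =
     ElimPlus (subst k s t) A (subst (Suc k) (lift 0 s) u) B (subst (Suc k) (lift 0 s) v)"
| "subst k s (Bang t) = Bang (subst k s t)"
| "subst k s (ElimBang t A u) = ElimBang (subst k s t) A (subst (Suc k) (lift 0 s) u)"
| "subst k s (TLam t) = TLam (subst k (tlift 0 s) t)"
| "subst k s (TApp t A) = TApp (subst k s t) A"

text \<open>
  A finite set of declarations is a finite partial map from term variables to propositions.
  The linear and the non-linear context of a sequent share one index space and declare
  different variables.  Below a binder, the new variable is index \<open>0\<close>: \<open>decl A \<Gamma>\<close> declares it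
  with proposition \<open>A\<close>, whereas \<open>skip \<Gamma>\<close> is \<open>\<Gamma>\<close> itself, reindexed, not declaring it.
\<close>

type_synonym ctxt = "nat \<rightharpoonup> lprop"

definition wf_ctxts :: "ctxt \<Rightarrow> ctxt \<Rightarrow> bool" where
  "wf_ctxts \<Xi> \<Gamma> \<longleftrightarrow> finite (dom \<Xi>) \<and> finite (dom \<Gamma>) \<and> dom \<Xi> \<inter> dom \<Gamma> = {}"

definition decl :: "lprop \<Rightarrow> ctxt \<Rightarrow> ctxt" where
  "decl A \<Gamma> = case_nat (Some A) \<Gamma>"

definition skip :: "ctxt \<Rightarrow> ctxt" where
  "skip \<Gamma> = case_nat None \<Gamma>"

definition ctxt_plift :: "ctxt \<Rightarrow> ctxt" where
  "ctxt_plift \<Gamma> = (\<lambda>i. map_option (plift 0) (\<Gamma> i))"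

text \<open>
  \<open>\<Gamma> ++ \<Delta>\<close> occurs only for contexts with disjoint domains, where it is the disjoint union.
  In \<open>t_TLam\<close>, lifting the contexts makes the bound proposition variable (index \<open>0\<close> in
  the premise) not free in them; this is the side condition of \<open>\<forall>\<close>-introduction.
\<close>

inductive typing :: "ctxt \<Rightarrow> ctxt \<Rightarrow> 's trm \<Rightarrow> lprop \<Rightarrow> bool"
  (\<open>_ \<Zsemi> _ \<turnstile> _ \<Colon> _\<close> [50, 50, 50, 50] 50) where
  t_LinVar: "wf_ctxts \<Xi> [i \<mapsto> A] \<Longrightarrow> \<Xi> \<Zsemi> [i \<mapsto> A] \<turnstile> Var i \<Colon> A"
| t_Var: "wf_ctxts \<Xi> Map.empty \<Longrightarrow> \<Xi> i = Some A \<Longrightarrow> \<Xi> \<Zsemi> Map.empty \<turnstile> Var i \<Colon> A"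
| t_Sum: "\<Xi> \<Zsemi> \<Gamma> \<turnstile> t \<Colon> A \<Longrightarrow> \<Xi> \<Zsemi> \<Gamma> \<turnstile> u \<Colon> A \<Longrightarrow> \<Xi> \<Zsemi> \<Gamma> \<turnstile> t \<boxplus> u \<Colon> A"
| t_Scal: "\<Xi> \<Zsemi> \<Gamma> \<turnstile> t \<Colon> A \<Longrightarrow> \<Xi> \<Zsemi> \<Gamma> \<turnstile> a \<bullet> t \<Colon> A"
| t_Star: "wf_ctxts \<Xi> Map.empty \<Longrightarrow> \<Xi> \<Zsemi> Map.empty \<turnstile> Star a \<Colon> One"
| t_ElimOne: "\<Xi> \<Zsemi> \<Gamma> \<turnstile> t \<Colon> One \<Longrightarrow> \<Xi> \<Zsemi> \<Delta> \<turnstile> u \<Colon> A \<Longrightarrow> dom \<Gamma> \<inter> dom \<Delta> = {}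
    \<Longrightarrow> \<Xi> \<Zsemi> \<Gamma> ++ \<Delta> \<turnstile> ElimOne t u \<Colon> A"
| t_Lam: "skip \<Xi> \<Zsemi> decl A \<Gamma> \<turnstile> t \<Colon> B \<Longrightarrow> \<Xi> \<Zsemi> \<Gamma> \<turnstile> Lam A t \<Colon> A \<multimap> B"
| t_App: "\<Xi> \<Zsemi> \<Gamma> \<turnstile> t \<Colon> A \<multimap> B \<Longrightarrow> \<Xi> \<Zsemi> \<Delta> \<turnstile> u \<Colon> A \<Longrightarrow> dom \<Gamma> \<inter> dom \<Delta> = {}
    \<Longrightarrow> \<Xi> \<Zsemi> \<Gamma> ++ \<Delta> \<turnstile> App t u \<Colon> B"
| t_Tens: "\<Xi> \<Zsemi> \<Gamma> \<turnstile> t \<Colon> A \<Longrightarrow> \<Xi> \<Zsemi> \<Delta> \<turnstile> u \<Colon> B \<Longrightarrow> dom \<Gamma> \<inter> dom \<Delta> = {}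
    \<Longrightarrow> \<Xi> \<Zsemi> \<Gamma> ++ \<Delta> \<turnstile> Tens t u \<Colon> A \<otimes> B"
| t_ElimTensor: "\<Xi> \<Zsemi> \<Gamma> \<turnstile> t \<Colon> A \<otimes> B \<Longrightarrow> skip (skip \<Xi>) \<Zsemi> decl B (decl A \<Delta>) \<turnstile> u \<Colon> C
    \<Longrightarrow> dom \<Gamma> \<inter> dom \<Delta> = {} \<Longrightarrow> \<Xi> \<Zsemi> \<Gamma> ++ \<Delta> \<turnstile> ElimTensor t A B u \<Colon> C"
| t_Unit: "wf_ctxts \<Xi> \<Gamma> \<Longrightarrow> \<Xi> \<Zsemi> \<Gamma> \<turnstile> Unit \<Colon> Top"
| t_ElimZero: "\<Xi> \<Zsemi> \<Gamma> \<turnstile> t \<Colon> Zero \<Longrightarrow> wf_ctxts \<Xi> \<Delta> \<Longrightarrow> dom \<Gamma> \<inter> dom \<Delta> = {}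
    \<Longrightarrow> \<Xi> \<Zsemi> \<Gamma> ++ \<Delta> \<turnstile> ElimZero t \<Colon> C"
| t_Pair: "\<Xi> \<Zsemi> \<Gamma> \<turnstile> t \<Colon> A \<Longrightarrow> \<Xi> \<Zsemi> \<Gamma> \<turnstile> u \<Colon> B \<Longrightarrow> \<Xi> \<Zsemi> \<Gamma> \<turnstile> Pair t u \<Colon> A \<sqinter> B"
| t_ElimWith1: "\<Xi> \<Zsemi> \<Gamma> \<turnstile> t \<Colon> A \<sqinter> B \<Longrightarrow> skip \<Xi> \<Zsemi> decl A \<Delta> \<turnstile> u \<Colon> C
    \<Longrightarrow> dom \<Gamma> \<inter> dom \<Delta> = {} \<Longrightarrow> \<Xi> \<Zsemi> \<Gamma> ++ \<Delta> \<turnstile> ElimWith1 t A u \<Colon> C"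
| t_ElimWith2: "\<Xi> \<Zsemi> \<Gamma> \<turnstile> t \<Colon> A \<sqinter> B \<Longrightarrow> skip \<Xi> \<Zsemi> decl B \<Delta> \<turnstile> u \<Colon> C
    \<Longrightarrow> dom \<Gamma> \<inter> dom \<Delta> = {} \<Longrightarrow> \<Xi> \<Zsemi> \<Gamma> ++ \<Delta> \<turnstile> ElimWith2 t B u \<Colon> C"
| t_Inl: "\<Xi> \<Zsemi> \<Gamma> \<turnstile> t \<Colon> A \<Longrightarrow> \<Xi> \<Zsemi> \<Gamma> \<turnstile> Inl t \<Colon> A \<oplus> B"
| t_Inr: "\<Xi> \<Zsemi> \<Gamma> \<turnstile> t \<Colon> B \<Longrightarrow> \<Xi> \<Zsemi> \<Gamma> \<turnstile> Inr t \<Colon> A \<oplus> B"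
| t_ElimPlus: "\<Xi> \<Zsemi> \<Gamma> \<turnstile> t \<Colon> A \<oplus> B \<Longrightarrow> skip \<Xi> \<Zsemi> decl A \<Delta> \<turnstile> u \<Colon> C
    \<Longrightarrow> skip \<Xi> \<Zsemi> decl B \<Delta> \<turnstile> v \<Colon> C \<Longrightarrow> dom \<Gamma> \<inter> dom \<Delta> = {}
    \<Longrightarrow> \<Xi> \<Zsemi> \<Gamma> ++ \<Delta> \<turnstile> ElimPlus t A u B v \<Colon> C"
| t_Bang: "\<Xi> \<Zsemi> Map.empty \<turnstile> t \<Colon> A \<Longrightarrow> \<Xi> \<Zsemi> Map.empty \<turnstile> Bang t \<Colon> OfCourse A"
| t_ElimBang: "\<Xi> \<Zsemi> \<Gamma> \<turnstile> t \<Colon> OfCourse A \<Longrightarrow> decl A \<Xi> \<Zsemi> skip \<Delta> \<turnstile> u \<Colon> B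
    \<Longrightarrow> dom \<Gamma> \<inter> dom \<Delta> = {} \<Longrightarrow> \<Xi> \<Zsemi> \<Gamma> ++ \<Delta> \<turnstile> ElimBang t A u \<Colon> B"
| t_TLam: "ctxt_plift \<Xi> \<Zsemi> ctxt_plift \<Gamma> \<turnstile> t \<Colon> A \<Longrightarrow> \<Xi> \<Zsemi> \<Gamma> \<turnstile> TLam t \<Colon> Forall A"
| t_TApp: "\<Xi> \<Zsemi> \<Gamma> \<turnstile> t \<Colon> Forall B \<Longrightarrow> \<Xi> \<Zsemi> \<Gamma> \<turnstile> TApp t A \<Colon> psubst 0 A B"

text \<open>
  The scalars form a semiring with \<open>0\<close> and \<open>1\<close>; the sort avoids \<open>semiring_1\<close>, which would
  add \<open>0 \<noteq> 1\<close>.  In \<open>r_Tensor\<close>, the lifted \<open>v\<close> does not contain the variable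
  replaced by \<open>u\<close>, so the nested substitutions amount to the simultaneous \<open>(u/x, v/y)w\<close>.
\<close>

inductive step :: "'s::{semiring_0,monoid_mult} trm \<Rightarrow> 's trm \<Rightarrow> bool"
  (infix \<open>\<leadsto>\<close> 50) where
  r_One: "ElimOne (Star a) t \<leadsto> a \<bullet> t"
| r_Lolli: "App (Lam A t) u \<leadsto> subst 0 u t"
| r_Tensor: "ElimTensor (Tens u v) A B w \<leadsto> subst 0 u (subst 0 (lift 0 v) w)"
| r_With1: "ElimWith1 (Pair t1 t2) A v \<leadsto> subst 0 t1 v"
| r_With2: "ElimWith2 (Pair t1 t2) B v \<leadsto> subst 0 t2 v"
| r_PlusL: "ElimPlus (Inl t) A v B w \<leadsto> subst 0 t v"
| r_PlusR: "ElimPlus (Inr u) A v B w \<leadsto> subst 0 u w"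
| r_Bang: "ElimBang (Bang t) A u \<leadsto> subst 0 t u"
| r_Forall: "TApp (TLam t) A \<leadsto> tsubst 0 A t"
| r_Sum_Star: "Star a \<boxplus> Star b \<leadsto> Star (a + b)"
| r_Sum_Lam: "Lam A t \<boxplus> Lam A u \<leadsto> Lam A (t \<boxplus> u)"
| r_Sum_ElimTensor: "ElimTensor (t \<boxplus> u) A B v \<leadsto> ElimTensor t A B v \<boxplus> ElimTensor u A B v"
| r_Sum_Unit: "Unit \<boxplus> Unit \<leadsto> Unit"
| r_Sum_Pair: "Pair t u \<boxplus> Pair v w \<leadsto> Pair (t \<boxplus> v) (u \<boxplus> w)"
| r_Sum_ElimPlus: "ElimPlus (t \<boxplus> u) A v B w \<leadsto> ElimPlus t A v B w \<boxplus> ElimPlus u A v B w"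
| r_Sum_Bang: "Bang t \<boxplus> Bang u \<leadsto> Bang (t \<boxplus> u)"
| r_Sum_TLam: "TLam t \<boxplus> TLam u \<leadsto> TLam (t \<boxplus> u)"
| r_Scal_Star: "a \<bullet> Star b \<leadsto> Star (a * b)"
| r_Scal_Lam: "a \<bullet> Lam A t \<leadsto> Lam A (a \<bullet> t)"
| r_Scal_ElimTensor: "ElimTensor (a \<bullet> t) A B v \<leadsto> a \<bullet> ElimTensor t A B v"
| r_Scal_Unit: "a \<bullet> Unit \<leadsto> Unit"
| r_Scal_Pair: "a \<bullet> Pair t u \<leadsto> Pair (a \<bullet> t) (a \<bullet> u)"
| r_Scal_ElimPlus: "ElimPlus (a \<bullet> t) A v B w \<leadsto> a \<bullet> ElimPlus t A v B w"
| r_Scal_Bang: "a \<bullet> Bang t \<leadsto> Bang (a \<bullet> t)"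
| r_Scal_TLam: "a \<bullet> TLam t \<leadsto> TLam (a \<bullet> t)"
| c_Sum1: "t \<leadsto> t' \<Longrightarrow> t \<boxplus> u \<leadsto> t' \<boxplus> u"
| c_Sum2: "u \<leadsto> u' \<Longrightarrow> t \<boxplus> u \<leadsto> t \<boxplus> u'"
| c_Scal: "t \<leadsto> t' \<Longrightarrow> a \<bullet> t \<leadsto> a \<bullet> t'"
| c_ElimOne1: "t \<leadsto> t' \<Longrightarrow> ElimOne t u \<leadsto> ElimOne t' u"
| c_ElimOne2: "u \<leadsto> u' \<Longrightarrow> ElimOne t u \<leadsto> ElimOne t u'"
| c_Lam: "t \<leadsto> t' \<Longrightarrow> Lam A t \<leadsto> Lam A t'"
| c_App1: "t \<leadsto> t' \<Longrightarrow> App t u \<leadsto> App t' u"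
| c_App2: "u \<leadsto> u' \<Longrightarrow> App t u \<leadsto> App t u'"
| c_Tens1: "t \<leadsto> t' \<Longrightarrow> Tens t u \<leadsto> Tens t' u"
| c_Tens2: "u \<leadsto> u' \<Longrightarrow> Tens t u \<leadsto> Tens t u'"
| c_ElimTensor1: "t \<leadsto> t' \<Longrightarrow> ElimTensor t A B u \<leadsto> ElimTensor t' A B u"
| c_ElimTensor2: "u \<leadsto> u' \<Longrightarrow> ElimTensor t A B u \<leadsto> ElimTensor t A B u'"
| c_ElimZero: "t \<leadsto> t' \<Longrightarrow> ElimZero t \<leadsto> ElimZero t'"
| c_Pair1: "t \<leadsto> t' \<Longrightarrow> Pair t u \<leadsto> Pair t' u"
| c_Pair2: "u \<leadsto> u' \<Longrightarrow> Pair t u \<leadsto> Pair t u'"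
| c_ElimWith1_1: "t \<leadsto> t' \<Longrightarrow> ElimWith1 t A u \<leadsto> ElimWith1 t' A u"
| c_ElimWith1_2: "u \<leadsto> u' \<Longrightarrow> ElimWith1 t A u \<leadsto> ElimWith1 t A u'"
| c_ElimWith2_1: "t \<leadsto> t' \<Longrightarrow> ElimWith2 t B u \<leadsto> ElimWith2 t' B u"
| c_ElimWith2_2: "u \<leadsto> u' \<Longrightarrow> ElimWith2 t B u \<leadsto> ElimWith2 t B u'"
| c_Inl: "t \<leadsto> t' \<Longrightarrow> Inl t \<leadsto> Inl t'"
| c_Inr: "t \<leadsto> t' \<Longrightarrow> Inr t \<leadsto> Inr t'"
| c_ElimPlus1: "t \<leadsto> t' \<Longrightarrow> ElimPlus t A u B v \<leadsto> ElimPlus t' A u B v"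
| c_ElimPlus2: "u \<leadsto> u' \<Longrightarrow> ElimPlus t A u B v \<leadsto> ElimPlus t A u' B v"
| c_ElimPlus3: "v \<leadsto> v' \<Longrightarrow> ElimPlus t A u B v \<leadsto> ElimPlus t A u B v'"
| c_Bang: "t \<leadsto> t' \<Longrightarrow> Bang t \<leadsto> Bang t'"
| c_ElimBang1: "t \<leadsto> t' \<Longrightarrow> ElimBang t A u \<leadsto> ElimBang t' A u"
| c_ElimBang2: "u \<leadsto> u' \<Longrightarrow> ElimBang t A u \<leadsto> ElimBang t A u'"
| c_TLam: "t \<leadsto> t' \<Longrightarrow> TLam t \<leadsto> TLam t'"
| c_TApp: "t \<leadsto> t' \<Longrightarrow> TApp t A \<leadsto> TApp t' A"

end

(*
Subject reduction rests on three substitution lemmas: for propositions, for non-linear variables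
(replaced by terms typed in the empty linear context) and for linear variables, where the linear
context of the substituted term is added to exactly one side of every context split. On the other
side of the split the variable is undeclared, and a substitution for it is mere strengthening;
the lemma on non-linear variables includes this case. Inversion then settles every rule.
*)

theory Submission
  imports Defs
begin

section \<open>Commutation laws for de Bruijn lifting and substitution on propositions\<close>

section \<open>Propositions\<close>

text \<open>Inserting at \<open>c\<close> moves an insertion point at or above it up by one. With
  \<open>c = 0\<close> this lets a lifted substituend pass under \<open>Forall\<close> in the laws
  below.\<close>

lemma plift_plift: "c \<le> d \<Longrightarrow> plift c (plift d A) = plift (Suc d) (plift c A)"
  by (induction A arbitrary: c d) auto

text \<open>Substitution removes \<open>k\<close>, so position \<open>c\<close> of the result is
  position \<open>Suc c\<close> of \<open>A\<close>. The case \<open>k = 0\<close> handles the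
  result type of \<open>TApp\<close> under lifting.\<close>

lemma plift_psubst: "k \<le> c \<Longrightarrow> plift c (psubst k C A) = psubst k (plift c C) (plift (Suc c) A)"
  by (induction A arbitrary: k c C) (auto simp: plift_plift)

text \<open>With \<open>c = 0\<close>, carries a substitution through the lifted contexts of
  \<open>TLam\<close>.\<close>

lemma psubst_plift_above:
  "c \<le> k \<Longrightarrow> psubst (Suc k) (plift c C) (plift c A) = plift c (psubst k C A)"
  by (induction A arbitrary: k c C) (auto simp: plift_plift)

lemma psubst_plift [simp]: "psubst c C (plift c A) = A"
  by (induction A arbitrary: c C) auto

text \<open>The substitution lemma; \<open>j = 0\<close> makes the result type of
  \<open>TApp\<close> stable under substitution. When \<open>A\<close> is the variable
  \<open>Suc k\<close>, both sides reduce to \<open>C\<close>, by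
  \<open>psubst_plift\<close>.\<close>

lemma psubst_psubst:
  "j \<le> k \<Longrightarrow> psubst k C (psubst j D A) = psubst j (psubst k C D) (psubst (Suc k) (plift j C) A)"
  by (induction A arbitrary: j k C D) (auto simp: plift_plift psubst_plift_above)

section \<open>Mapping, insertion and deletion on contexts, and well-formedness\<close>

section \<open>Contexts\<close>

text \<open>Undoes the unfolding of singleton contexts by the induction method.\<close>

lemma singleton_ctxt_fold [simp]: "(\<lambda>j. if j = i then Some A else None) = [i \<mapsto> A]"
  by auto

text \<open>Covers \<open>ctxt_plift\<close>, lifting at any cutoff and substitution
  uniformly.\<close>

definition ctxt_map :: "(lprop \<Rightarrow> lprop) \<Rightarrow> ctxt \<Rightarrow> ctxt" where
  "ctxt_map f \<Gamma> = (\<lambda>i. map_option f (\<Gamma> i))"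

text \<open>The optional entry lets one weakening lemma treat both a new declaration and a mere
  reindexing; position 0 gives \<open>decl\<close> and \<open>skip\<close>.\<close>

definition ctxt_ins :: "nat \<Rightarrow> lprop option \<Rightarrow> ctxt \<Rightarrow> ctxt" where
  "ctxt_ins k p \<Gamma> = (\<lambda>i. if i < k then \<Gamma> i else if i = k then p else \<Gamma> (i - 1))"

text \<open>Closes the gap at \<open>k\<close>, in step with the renumbering done by
  \<open>subst k\<close>.\<close>

definition ctxt_del :: "nat \<Rightarrow> ctxt \<Rightarrow> ctxt" where
  "ctxt_del k \<Gamma> = (\<lambda>i. if i < k then \<Gamma> i else \<Gamma> (Suc i))"

lemma ctxt_plift_eq: "ctxt_plift = ctxt_map (plift 0)"
  by (simp add: fun_eq_iff ctxt_plift_def ctxt_map_def)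

lemma dom_decl [simp]: "dom (decl A \<Gamma>) = insert 0 (Suc ` dom \<Gamma>)"
proof (rule set_eqI)
  show "i \<in> dom (decl A \<Gamma>) \<longleftrightarrow> i \<in> insert 0 (Suc ` dom \<Gamma>)" for i
    by (cases i) (auto simp: decl_def)
qed

lemma dom_skip [simp]: "dom (skip \<Gamma>) = Suc ` dom \<Gamma>"
proof (rule set_eqI)
  show "i \<in> dom (skip \<Gamma>) \<longleftrightarrow> i \<in> Suc ` dom \<Gamma>" for i
    by (cases i) (auto simp: skip_def)
qed

lemma Suc_image_simps [simp]:
  "Suc i \<in> Suc ` M \<longleftrightarrow> i \<in> M" "Suc ` M \<inter> Suc ` N = {} \<longleftrightarrow> M \<inter> N = {}"
  by auto

lemma decl_skip_0 [simp]: "decl A \<Gamma> 0 = Some A" "skip \<Gamma> 0 = None"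
  by (simp_all add: decl_def skip_def)

lemma decl_skip_Suc [simp]: "decl A \<Gamma> (Suc i) = \<Gamma> i" "skip \<Gamma> (Suc i) = \<Gamma> i"
  by (simp_all add: decl_def skip_def)

lemma decl_skip_add [simp]:
  "decl A \<Gamma> ++ skip \<Delta> = decl A (\<Gamma> ++ \<Delta>)"
  "skip \<Gamma> ++ skip \<Delta> = skip (\<Gamma> ++ \<Delta>)"
  by (auto simp: fun_eq_iff decl_def skip_def map_add_def split: nat.splits)

lemma dom_ctxt_map [simp]: "dom (ctxt_map f \<Gamma>) = dom \<Gamma>"
  by (auto simp: ctxt_map_def)

lemma ctxt_map_simps [simp]:
  "ctxt_map f (decl A \<Gamma>) = decl (f A) (ctxt_map f \<Gamma>)"
  "ctxt_map f (skip \<Gamma>) = skip (ctxt_map f \<Gamma>)"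
  "ctxt_map f (\<Gamma> ++ \<Delta>) = ctxt_map f \<Gamma> ++ ctxt_map f \<Delta>"
  "ctxt_map f Map.empty = Map.empty"
  "ctxt_map f [i \<mapsto> A] = [i \<mapsto> f A]"
  by (auto simp: fun_eq_iff ctxt_map_def decl_def skip_def map_add_def split: nat.splits option.splits)

lemma skip_empty [simp]: "skip Map.empty = Map.empty"
  by (auto simp: fun_eq_iff skip_def split: nat.splits)

lemma ctxt_map_ctxt_map: "ctxt_map f (ctxt_map g \<Gamma>) = ctxt_map (f \<circ> g) \<Gamma>"
  by (auto simp: fun_eq_iff ctxt_map_def option.map_comp)

text \<open>Transfers a law on propositions to contexts, to move a map past the lifting in the
  premise of \<open>t_TLam\<close>.\<close>

lemma ctxt_map_plift_commute:
  "ctxt_map f (ctxt_map (plift 0) \<Gamma>) = ctxt_map (plift 0) (ctxt_map g \<Gamma>)"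
  if "\<And>A. f (plift 0 A) = plift 0 (g A)"
  using that by (simp add: ctxt_map_ctxt_map comp_def)

lemma ctxt_map_id [simp]: "ctxt_map (\<lambda>A. A) \<Gamma> = \<Gamma>"
  by (simp add: fun_eq_iff ctxt_map_def option.map_ident)

lemma ctxt_map_apply: "ctxt_map f \<Gamma> i = map_option f (\<Gamma> i)"
  by (simp add: ctxt_map_def)

lemma ctxt_ins_apply:
  "i < k \<Longrightarrow> ctxt_ins k p \<Gamma> i = \<Gamma> i"
  "\<not> i < k \<Longrightarrow> ctxt_ins k p \<Gamma> (Suc i) = \<Gamma> i"
  by (simp_all add: ctxt_ins_def)

lemma dom_ctxt_ins_None:
  "dom (ctxt_ins k None \<Gamma>) = (\<lambda>i. if i < k then i else Suc i) ` dom \<Gamma>"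
  by (force simp: ctxt_ins_def dom_def image_iff split: if_splits)

lemma dom_ctxt_ins_subset:
  "dom (ctxt_ins k p \<Gamma>) \<subseteq> insert k (dom (ctxt_ins k None \<Gamma>))"
  by (auto simp: ctxt_ins_def dom_def)

lemma ctxt_ins_simps [simp]:
  "ctxt_ins (Suc k) p (decl A \<Gamma>) = decl A (ctxt_ins k p \<Gamma>)"
  "ctxt_ins (Suc k) p (skip \<Gamma>) = skip (ctxt_ins k p \<Gamma>)"
  "ctxt_ins k None (\<Gamma> ++ \<Delta>) = ctxt_ins k None \<Gamma> ++ ctxt_ins k None \<Delta>"
  "ctxt_ins k None Map.empty = Map.empty"
  "ctxt_ins k None [i \<mapsto> A] = [if i < k then i else Suc i \<mapsto> A]"
  "ctxt_map f (ctxt_ins k p \<Gamma>) = ctxt_ins k (map_option f p) (ctxt_map f \<Gamma>)"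
  by (auto simp: fun_eq_iff ctxt_ins_def ctxt_map_def decl_def skip_def map_add_def
      split: nat.splits)

lemma ctxt_ins_0: "ctxt_ins 0 None = skip" "ctxt_ins 0 (Some A) = decl A"
  by (auto simp: fun_eq_iff ctxt_ins_def decl_def skip_def split: nat.splits)

text \<open>Only the first context can declare the new position, so it is never shared.\<close>

lemma disjoint_ctxt_ins:
  "dom \<Gamma> \<inter> dom \<Delta> = {} \<Longrightarrow> dom (ctxt_ins k p \<Gamma>) \<inter> dom (ctxt_ins k None \<Delta>) = {}"
  by (auto simp: ctxt_ins_def disjoint_iff domIff)

lemma wf_ctxt_ins: "wf_ctxts \<Xi> \<Gamma> \<Longrightarrow> wf_ctxts (ctxt_ins k p \<Xi>) (ctxt_ins k None \<Gamma>)"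
  unfolding wf_ctxts_def using finite_subset[OF dom_ctxt_ins_subset]
  by (metis disjoint_ctxt_ins dom_ctxt_ins_None finite_imageI finite_insert)

lemma ctxt_del_apply:
  "i < k \<Longrightarrow> ctxt_del k \<Gamma> i = \<Gamma> i"
  "k < i \<Longrightarrow> ctxt_del k \<Gamma> (i - Suc 0) = \<Gamma> i"
  by (auto simp: ctxt_del_def)

lemma dom_ctxt_del: "dom (ctxt_del k \<Gamma>) = (\<lambda>i. if i < k then i else Suc i) -` dom \<Gamma>"
  by (auto simp: ctxt_del_def split: if_splits)

lemma ctxt_del_simps [simp]:
  "ctxt_del (Suc k) (decl A \<Gamma>) = decl A (ctxt_del k \<Gamma>)"
  "ctxt_del (Suc k) (skip \<Gamma>) = skip (ctxt_del k \<Gamma>)"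
  "ctxt_del 0 (decl A \<Gamma>) = \<Gamma>"
  "ctxt_del 0 (skip \<Gamma>) = \<Gamma>"
  "ctxt_del k (\<Gamma> ++ \<Delta>) = ctxt_del k \<Gamma> ++ ctxt_del k \<Delta>"
  "ctxt_del k Map.empty = Map.empty"
  "ctxt_del k (ctxt_map f \<Gamma>) = ctxt_map f (ctxt_del k \<Gamma>)"
  by (auto simp: fun_eq_iff ctxt_del_def ctxt_map_def decl_def skip_def map_add_def
      split: nat.splits)

lemma ctxt_del_singleton:
  "ctxt_del k [k \<mapsto> A] = Map.empty"
  "i \<noteq> k \<Longrightarrow> ctxt_del k [i \<mapsto> A] = [if i < k then i else i - 1 \<mapsto> A]"
  by (auto simp: fun_eq_iff ctxt_del_def)

lemma disjoint_ctxt_del: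
  "dom \<Gamma> \<inter> dom \<Delta> = {} \<Longrightarrow> dom (ctxt_del k \<Gamma>) \<inter> dom (ctxt_del k \<Delta>) = {}"
  by (auto simp: dom_ctxt_del)

lemma finite_dom_ctxt_del: "finite (dom \<Gamma>) \<Longrightarrow> finite (dom (ctxt_del k \<Gamma>))"
  unfolding dom_ctxt_del by (rule finite_vimageI) (auto simp: inj_on_def split: if_splits)

lemma wf_ctxt_del: "wf_ctxts \<Xi> \<Gamma> \<Longrightarrow> wf_ctxts (ctxt_del k \<Xi>) (ctxt_del k \<Gamma>)"
  by (simp add: wf_ctxts_def disjoint_ctxt_del finite_dom_ctxt_del)

lemma wf_ctxts_add:
  "wf_ctxts \<Xi> \<Gamma> \<Longrightarrow> wf_ctxts \<Xi> \<Delta> \<Longrightarrow> wf_ctxts \<Xi> (\<Gamma> ++ \<Delta>)"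
  by (auto simp: wf_ctxts_def)

text \<open>Each binder declares its variable in at most one of the two contexts, and the common
  shift preserves finiteness and disjointness.\<close>

lemma wf_ctxts_binder:
  "wf_ctxts (skip \<Xi>) (decl A \<Gamma>) \<longleftrightarrow> wf_ctxts \<Xi> \<Gamma>"
  "wf_ctxts (decl A \<Xi>) (skip \<Gamma>) \<longleftrightarrow> wf_ctxts \<Xi> \<Gamma>"
  "wf_ctxts (skip \<Xi>) (skip \<Gamma>) \<longleftrightarrow> wf_ctxts \<Xi> \<Gamma>"
  "wf_ctxts (skip (skip \<Xi>)) (decl A (decl B \<Gamma>)) \<longleftrightarrow> wf_ctxts \<Xi> \<Gamma>"
  by (auto simp: wf_ctxts_def finite_image_iff disjoint_iff)

lemma wf_ctxt_map [simp]: "wf_ctxts (ctxt_map f \<Xi>) (ctxt_map f \<Gamma>) \<longleftrightarrow> wf_ctxts \<Xi> \<Gamma>"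
  by (simp add: wf_ctxts_def)

section \<open>Lifting of derivations and substitution for proposition variables\<close>

section \<open>Renaming and substitution in derivations\<close>

text \<open>Supplies the well-formedness that \<open>Unit\<close> and \<open>ElimZero\<close> ask
  for when they absorb the linear context of a substituted term.\<close>

lemma typing_wf: "\<Xi> \<Zsemi> \<Gamma> \<turnstile> t \<Colon> A \<Longrightarrow> wf_ctxts \<Xi> \<Gamma>"
  by (induction rule: typing.induct)
    (auto simp: wf_ctxts_binder ctxt_plift_eq intro: wf_ctxts_add)

lemma typing_tlift:
  "\<Xi> \<Zsemi> \<Gamma> \<turnstile> t \<Colon> A \<Longrightarrow>
    ctxt_map (plift c) \<Xi> \<Zsemi> ctxt_map (plift c) \<Gamma> \<turnstile> tlift c t \<Colon> plift c A"
proof (induction arbitrary: c rule: typing.induct)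
  case (t_TLam \<Xi> \<Gamma> t A)
  then show ?case
    using ctxt_map_plift_commute[of "plift (Suc c)" "plift c"] t_TLam.IH[of "Suc c"]
    by (auto simp: ctxt_plift_eq plift_plift intro!: typing.t_TLam)
next
  case (t_TApp \<Xi> \<Gamma> t B A)
  then show ?case
    using typing.t_TApp by (fastforce simp: plift_psubst)
qed (auto simp: ctxt_map_apply wf_ctxts_def intro!: typing.intros del: equalityI)

lemma typing_tsubst:
  "\<Xi> \<Zsemi> \<Gamma> \<turnstile> t \<Colon> A \<Longrightarrow>
    ctxt_map (psubst k C) \<Xi> \<Zsemi> ctxt_map (psubst k C) \<Gamma> \<turnstile> tsubst k C t \<Colon> psubst k C A"
proof (induction arbitrary: k C rule: typing.induct)
  case (t_TLam \<Xi> \<Gamma> t A)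
  then show ?case
    using ctxt_map_plift_commute[of "psubst (Suc k) (plift 0 C)" "psubst k C"]
      t_TLam.IH[of "Suc k" "plift 0 C"]
    by (auto simp: ctxt_plift_eq psubst_plift_above intro!: typing.t_TLam)
next
  case (t_TApp \<Xi> \<Gamma> t B A)
  then show ?case
    using typing.t_TApp by (fastforce simp: psubst_psubst)
qed (auto simp: ctxt_map_apply wf_ctxts_def intro!: typing.intros del: equalityI)

text \<open>Weakening for the non-linear context only: the linear one is reindexed but gains no
  declaration, since linear variables cannot be discarded in general.\<close>

lemma typing_lift:
  "\<Xi> \<Zsemi> \<Gamma> \<turnstile> t \<Colon> A \<Longrightarrow> ctxt_ins c p \<Xi> \<Zsemi> ctxt_ins c None \<Gamma> \<turnstile> lift c t \<Colon> A"
proof (induction arbitrary: c p rule: typing.induct)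
  case (t_LinVar \<Xi> i A)
  then show ?case
    using wf_ctxt_ins[OF t_LinVar, of c p] by (auto intro: typing.t_LinVar)
next
  case (t_Var \<Xi> i A)
  then show ?case
    using wf_ctxt_ins[OF t_Var(1), of c p] by (auto simp: ctxt_ins_apply intro!: typing.t_Var)
next
  case (t_Star \<Xi> a)
  then show ?case
    using wf_ctxt_ins[OF t_Star, of c p] by (auto intro: typing.t_Star)
next
  case (t_TLam \<Xi> \<Gamma> t A)
  then show ?case
    \<comment> \<open>Under a type binder the inserted entry is lifted along with the
      contexts.\<close>
    using t_TLam.IH[of c "map_option (plift 0) p"]
    by (auto simp: ctxt_plift_eq intro!: typing.t_TLam)
qed (auto simp: disjoint_ctxt_ins wf_ctxt_ins intro!: typing.intros del: equalityI,
    (metis ctxt_ins_simps(1,2))+)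

text \<open>The forms needed when a substituted term passes under a linear or a non-linear binder;
  the last two keep the linear context empty, as substitution for non-linear variables
  demands.\<close>

lemma typing_lift_binder:
  "\<Xi> \<Zsemi> \<Gamma> \<turnstile> t \<Colon> A \<Longrightarrow> skip \<Xi> \<Zsemi> skip \<Gamma> \<turnstile> lift 0 t \<Colon> A"
  "\<Xi> \<Zsemi> \<Gamma> \<turnstile> t \<Colon> A \<Longrightarrow> decl B \<Xi> \<Zsemi> skip \<Gamma> \<turnstile> lift 0 t \<Colon> A"
  "\<Xi> \<Zsemi> Map.empty \<turnstile> t \<Colon> A \<Longrightarrow> skip \<Xi> \<Zsemi> Map.empty \<turnstile> lift 0 t \<Colon> A"
  "\<Xi> \<Zsemi> Map.empty \<turnstile> t \<Colon> A \<Longrightarrow> decl B \<Xi> \<Zsemi> Map.empty \<turnstile> lift 0 t \<Colon> A"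
  using typing_lift[of \<Xi> \<Gamma> t A 0 None] typing_lift[of \<Xi> \<Gamma> t A 0 "Some B"]
    typing_lift[of \<Xi> Map.empty t A 0 None] typing_lift[of \<Xi> Map.empty t A 0 "Some B"]
  by (simp_all add: ctxt_ins_0)

section \<open>Substitution for term variables\<close>

text \<open>A non-linear variable may occur any number of times, also under \<open>Bang\<close>, so
  \<open>s\<close> must consume no linear variables. Its typing is demanded only if
  \<open>\<Xi>\<close> declares \<open>k\<close>.\<close>

lemma typing_subst_unrestricted:
  "\<lbrakk>\<Xi> \<Zsemi> \<Gamma> \<turnstile> t \<Colon> A; \<Gamma> k = None;
    \<And>B. \<Xi> k = Some B \<Longrightarrow> ctxt_del k \<Xi> \<Zsemi> Map.empty \<turnstile> s \<Colon> B\<rbrakk> \<Longrightarrow>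
    ctxt_del k \<Xi> \<Zsemi> ctxt_del k \<Gamma> \<turnstile> subst k s t \<Colon> A"
proof (induction arbitrary: k s rule: typing.induct)
  case (t_LinVar \<Xi> i A)
  \<comment> \<open>The linear context is undefined at \<open>k\<close> but declares
    \<open>i\<close>.\<close>
  moreover from this have "i \<noteq> k"
    by auto
  ultimately show ?case
    using wf_ctxt_del[OF t_LinVar(1), of k]
    by (auto simp: ctxt_del_singleton intro: typing.t_LinVar)
next
  case (t_Var \<Xi> i A)
  \<comment> \<open>For \<open>i = k\<close> the result is \<open>s\<close>, typed by the last
    premise; otherwise the renumbered variable is still declared.\<close>
  then show ?case
    using wf_ctxt_del[OF t_Var(1), of k]
    by (auto simp: ctxt_del_apply intro!: typing.t_Var)
next
  case (t_Star \<Xi> a)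
  then show ?case
    using wf_ctxt_del[OF t_Star(1), of k] by (auto intro: typing.t_Star)
next
  case (t_TLam \<Xi> \<Gamma> t A)
  show ?case
    using t_TLam.IH[of k "tlift 0 s"] t_TLam.prems typing_tlift[of "ctxt_del k \<Xi>" Map.empty s _ 0]
    by (force simp: ctxt_plift_eq ctxt_map_apply[of _ _ k] intro!: typing.t_TLam)
next
  case (t_Lam \<Xi> A \<Gamma> t B)
  show ?case
    using t_Lam t_Lam.IH[of "Suc k" "lift 0 s"]
    by (auto simp: disjoint_ctxt_del typing_lift_binder intro!: typing.t_Lam del: equalityI)
next
  case (t_ElimTensor \<Xi> \<Gamma> t A B \<Delta> u C)
  show ?case
    using t_ElimTensor t_ElimTensor.IH(1)[of k s] t_ElimTensor.IH(2)[of "Suc (Suc k)" "lift 0 (lift 0 s)"]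
    by (auto simp: disjoint_ctxt_del typing_lift_binder intro!: typing.t_ElimTensor del: equalityI)
next
  case (t_ElimWith1 \<Xi> \<Gamma> t A B \<Delta> u C)
  show ?case
    using t_ElimWith1 t_ElimWith1.IH(1)[of k s] t_ElimWith1.IH(2)[of "Suc k" "lift 0 s"]
    by (auto simp: disjoint_ctxt_del typing_lift_binder intro!: typing.t_ElimWith1 del: equalityI)
next
  case (t_ElimWith2 \<Xi> \<Gamma> t A B \<Delta> u C)
  show ?case
    using t_ElimWith2 t_ElimWith2.IH(1)[of k s] t_ElimWith2.IH(2)[of "Suc k" "lift 0 s"]
    by (auto simp: disjoint_ctxt_del typing_lift_binder intro!: typing.t_ElimWith2 del: equalityI)
next
  case (t_ElimPlus \<Xi> \<Gamma> t A B \<Delta> u C v)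
  show ?case
    using t_ElimPlus t_ElimPlus.IH(1)[of k s] t_ElimPlus.IH(2,3)[of "Suc k" "lift 0 s"]
    by (auto simp: disjoint_ctxt_del typing_lift_binder intro!: typing.t_ElimPlus del: equalityI)
next
  case (t_ElimBang \<Xi> \<Gamma> t A \<Delta> u B)
  show ?case
    using t_ElimBang t_ElimBang.IH(1)[of k s] t_ElimBang.IH(2)[of "Suc k" "lift 0 s"]
    by (auto simp: disjoint_ctxt_del typing_lift_binder intro!: typing.t_ElimBang del: equalityI)
qed (auto simp: disjoint_ctxt_del wf_ctxt_del intro!: typing.intros del: equalityI)

lemma typing_subst_undeclared:
  "\<lbrakk>\<Xi> \<Zsemi> \<Gamma> \<turnstile> t \<Colon> A; \<Gamma> k = None; \<Xi> k = None\<rbrakk> \<Longrightarrow>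
    ctxt_del k \<Xi> \<Zsemi> ctxt_del k \<Gamma> \<turnstile> subst k s t \<Colon> A"
  by (rule typing_subst_unrestricted) auto

text \<open>By disjointness only one side declares \<open>k\<close>, and \<open>\<Theta>\<close>
  joins that side. Each case supplies the regrouped union and the disjointness that the typing rule
  requires.\<close>

lemma ctxt_del_add_cases:
  assumes "dom \<Gamma> \<inter> dom \<Delta> = {}" "(\<Gamma> ++ \<Delta>) k = Some D"
    and "dom (ctxt_del k (\<Gamma> ++ \<Delta>)) \<inter> dom \<Theta> = {}"
  obtains
    (left) "\<Gamma> k = Some D" "\<Delta> k = None" "dom (ctxt_del k \<Gamma>) \<inter> dom \<Theta> = {}"
      "ctxt_del k (\<Gamma> ++ \<Delta>) ++ \<Theta> = (ctxt_del k \<Gamma> ++ \<Theta>) ++ ctxt_del k \<Delta>"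
      "dom (ctxt_del k \<Gamma> ++ \<Theta>) \<inter> dom (ctxt_del k \<Delta>) = {}"
  | (right) "\<Gamma> k = None" "\<Delta> k = Some D" "dom (ctxt_del k \<Delta>) \<inter> dom \<Theta> = {}"
      "ctxt_del k (\<Gamma> ++ \<Delta>) ++ \<Theta> = ctxt_del k \<Gamma> ++ (ctxt_del k \<Delta> ++ \<Theta>)"
      "dom (ctxt_del k \<Gamma>) \<inter> dom (ctxt_del k \<Delta> ++ \<Theta>) = {}"
proof -
  have disj: "dom (ctxt_del k \<Gamma>) \<inter> dom \<Theta> = {}" "dom (ctxt_del k \<Delta>) \<inter> dom \<Theta> = {}"
    "dom (ctxt_del k \<Gamma>) \<inter> dom (ctxt_del k \<Delta>) = {}"
    using assms(3) disjoint_ctxt_del[OF assms(1)] by auto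
  show thesis
  proof (cases "\<Delta> k")
    case None
    moreover from this have "\<Gamma> k = Some D"
      using assms(2) by (simp add: map_add_def)
    \<comment> \<open>\<open>\<Theta>\<close> is moved in front of the rest of
      \<open>\<Delta>\<close>, which disjointness permits; the other case needs only
      associativity.\<close>
    moreover have "ctxt_del k (\<Gamma> ++ \<Delta>) ++ \<Theta> = (ctxt_del k \<Gamma> ++ \<Theta>) ++ ctxt_del k \<Delta>"
      using map_add_comm[OF disj(2)] by (simp flip: map_add_assoc)
    ultimately show thesis
      using disj by (intro left) auto
  next
    case (Some E)
    moreover from this have "\<Gamma> k = None" "E = D"
      using assms(1,2) by (auto simp: map_add_def)
    ultimately show thesis
      using disj by (intro right) auto
  qed
qed

text \<open>At a split, \<open>\<Theta>\<close> follows \<open>k\<close> into one premise; where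
  premises share a linear context, as in \<open>Sum\<close> and \<open>Pair\<close>, it enters each
  of them.\<close>

lemma typing_subst_linear:
  "\<lbrakk>\<Xi> \<Zsemi> \<Gamma> \<turnstile> t \<Colon> A; \<Gamma> k = Some D; \<Xi> k = None; ctxt_del k \<Xi> \<Zsemi> \<Theta> \<turnstile> s \<Colon> D;
    dom (ctxt_del k \<Gamma>) \<inter> dom \<Theta> = {}\<rbrakk> \<Longrightarrow>
    ctxt_del k \<Xi> \<Zsemi> ctxt_del k \<Gamma> ++ \<Theta> \<turnstile> subst k s t \<Colon> A"
proof (induction arbitrary: k D \<Theta> s rule: typing.induct)
  case (t_LinVar \<Xi> i A)
  moreover from this have "i = k"
    by (auto split: if_splits)
  ultimately show ?case
    by (auto simp: ctxt_del_singleton)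
next
  case (t_Unit \<Xi> \<Gamma>)
  then show ?case
    \<comment> \<open>\<open>Unit\<close> accepts any linear context, so only well-formedness of the
      enlarged one is at stake.\<close>
    using wf_ctxts_add[OF wf_ctxt_del typing_wf] by (auto intro!: typing.t_Unit)
next
  case (t_Lam \<Xi> A \<Gamma> t B)
  show ?case
    using t_Lam.IH[of "Suc k" D "skip \<Theta>" "lift 0 s"] t_Lam.prems
    by (auto simp: typing_lift_binder intro!: typing.t_Lam del: equalityI)
next
  case (t_TLam \<Xi> \<Gamma> t A)
  show ?case
    using t_TLam.IH[of k "plift 0 D" "ctxt_map (plift 0) \<Theta>" "tlift 0 s"] t_TLam.prems
      typing_tlift[of "ctxt_del k \<Xi>" \<Theta> s D 0]
    by (auto simp: ctxt_plift_eq ctxt_map_apply[of _ _ k] intro!: typing.t_TLam del: equalityI)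
next
  \<comment> \<open>Model for all rules with a split: the induction hypothesis serves the premise
    that declares \<open>k\<close>, strengthening serves the other.\<close>
  case (t_ElimOne \<Xi> \<Gamma> t \<Delta> u A)
  show ?case
    using t_ElimOne.hyps(3) t_ElimOne.prems(1,4)
  proof (cases rule: ctxt_del_add_cases)
    case left
    show ?thesis
      unfolding left(4) subst.simps
      using t_ElimOne.IH(1)[OF left(1) t_ElimOne.prems(2,3) left(3)] left(2,5) t_ElimOne.prems(2)
        typing_subst_undeclared[OF t_ElimOne.hyps(2) left(2) t_ElimOne.prems(2), of s]
      by (auto intro!: typing.t_ElimOne del: equalityI)
  next
    case right
    show ?thesis
      unfolding right(4) subst.simps
      using typing_subst_undeclared[OF t_ElimOne.hyps(1) right(1) t_ElimOne.prems(2), of s] right(2,3,5) t_ElimOne.prems(2,3)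
        t_ElimOne.IH(2)[OF right(2) t_ElimOne.prems(2,3) right(3)]
      by (auto simp: typing_lift_binder simp del: map_add_assoc intro!: typing.t_ElimOne del: equalityI)
  qed
next
  case (t_App \<Xi> \<Gamma> t A B \<Delta> u)
  show ?case
    using t_App.hyps(3) t_App.prems(1,4)
  proof (cases rule: ctxt_del_add_cases)
    case left
    show ?thesis
      unfolding left(4) subst.simps
      using t_App.IH(1)[OF left(1) t_App.prems(2,3) left(3)] left(2,5) t_App.prems(2)
        typing_subst_undeclared[OF t_App.hyps(2) left(2) t_App.prems(2), of s]
      by (auto intro!: typing.t_App del: equalityI)
  next
    case right
    show ?thesis
      unfolding right(4) subst.simps
      using typing_subst_undeclared[OF t_App.hyps(1) right(1) t_App.prems(2), of s] right(2,3,5) t_App.prems(2,3)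
        t_App.IH(2)[OF right(2) t_App.prems(2,3) right(3)]
      by (auto simp: typing_lift_binder simp del: map_add_assoc intro!: typing.t_App del: equalityI)
  qed
next
  case (t_Tens \<Xi> \<Gamma> t A \<Delta> u B)
  show ?case
    using t_Tens.hyps(3) t_Tens.prems(1,4)
  proof (cases rule: ctxt_del_add_cases)
    case left
    show ?thesis
      unfolding left(4) subst.simps
      using t_Tens.IH(1)[OF left(1) t_Tens.prems(2,3) left(3)] left(2,5) t_Tens.prems(2)
        typing_subst_undeclared[OF t_Tens.hyps(2) left(2) t_Tens.prems(2), of s]
      by (auto intro!: typing.t_Tens del: equalityI)
  next
    case right
    show ?thesis
      unfolding right(4) subst.simps
      using typing_subst_undeclared[OF t_Tens.hyps(1) right(1) t_Tens.prems(2), of s] right(2,3,5) t_Tens.prems(2,3)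
        t_Tens.IH(2)[OF right(2) t_Tens.prems(2,3) right(3)]
      by (auto simp: typing_lift_binder simp del: map_add_assoc intro!: typing.t_Tens del: equalityI)
  qed
next
  case (t_ElimTensor \<Xi> \<Gamma> t A B \<Delta> u C)
  show ?case
    using t_ElimTensor.hyps(3) t_ElimTensor.prems(1,4)
  proof (cases rule: ctxt_del_add_cases)
    case left
    show ?thesis
      unfolding left(4) subst.simps
      using t_ElimTensor.IH(1)[OF left(1) t_ElimTensor.prems(2,3) left(3)] left(2,5) t_ElimTensor.prems(2)
        typing_subst_undeclared[OF t_ElimTensor.hyps(2), of "Suc (Suc k)" "lift 0 (lift 0 s)"]
      by (auto intro!: typing.t_ElimTensor del: equalityI)
  next
    case right
    show ?thesis
      unfolding right(4) subst.simps
      using typing_subst_undeclared[OF t_ElimTensor.hyps(1) right(1) t_ElimTensor.prems(2), of s] right(2,3,5) t_ElimTensor.prems(2,3)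
        \<comment> \<open>Two binders are crossed, hence the double shift of \<open>k\<close>,
          \<open>\<Theta>\<close> and \<open>s\<close>.\<close>
        t_ElimTensor.IH(2)[of "Suc (Suc k)" D "skip (skip \<Theta>)" "lift 0 (lift 0 s)"]
      by (auto simp: typing_lift_binder simp del: map_add_assoc intro!: typing.t_ElimTensor del: equalityI)
  qed
next
  case (t_ElimZero \<Xi> \<Gamma> t \<Delta> C)
  show ?case
    using t_ElimZero.hyps(3) t_ElimZero.prems(1,4)
  proof (cases rule: ctxt_del_add_cases)
    case left
    show ?thesis
      unfolding left(4) subst.simps
      using t_ElimZero.IH(1)[OF left(1) t_ElimZero.prems(2,3) left(3)] left(2,5) t_ElimZero.prems(2)
        wf_ctxt_del[OF t_ElimZero.hyps(2), of k]
      by (auto intro!: typing.t_ElimZero del: equalityI)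
  next
    case right
    show ?thesis
      unfolding right(4) subst.simps
      \<comment> \<open>\<open>\<Theta>\<close> joins the absorbed context, while \<open>t\<close>
        is only strengthened.\<close>
      using typing_subst_undeclared[OF t_ElimZero.hyps(1) right(1) t_ElimZero.prems(2), of s] right(2,3,5) t_ElimZero.prems(2,3)
        wf_ctxts_add[OF wf_ctxt_del[OF t_ElimZero.hyps(2)] typing_wf[OF t_ElimZero.prems(3)]]
      by (auto simp: typing_lift_binder simp del: map_add_assoc intro!: typing.t_ElimZero del: equalityI)
  qed
next
  case (t_ElimWith1 \<Xi> \<Gamma> t A B \<Delta> u C)
  show ?case
    using t_ElimWith1.hyps(3) t_ElimWith1.prems(1,4)
  proof (cases rule: ctxt_del_add_cases)
    case left
    show ?thesis
      unfolding left(4) subst.simps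
      using t_ElimWith1.IH(1)[OF left(1) t_ElimWith1.prems(2,3) left(3)] left(2,5) t_ElimWith1.prems(2)
        typing_subst_undeclared[OF t_ElimWith1.hyps(2), of "Suc k" "lift 0 s"]
      by (auto intro!: typing.t_ElimWith1 del: equalityI)
  next
    case right
    show ?thesis
      unfolding right(4) subst.simps
      using typing_subst_undeclared[OF t_ElimWith1.hyps(1) right(1) t_ElimWith1.prems(2), of s] right(2,3,5) t_ElimWith1.prems(2,3)
        t_ElimWith1.IH(2)[of "Suc k" D "skip \<Theta>" "lift 0 s"]
      by (auto simp: typing_lift_binder simp del: map_add_assoc intro!: typing.t_ElimWith1 del: equalityI)
  qed
next
  case (t_ElimWith2 \<Xi> \<Gamma> t A B \<Delta> u C)
  show ?case
    using t_ElimWith2.hyps(3) t_ElimWith2.prems(1,4)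
  proof (cases rule: ctxt_del_add_cases)
    case left
    show ?thesis
      unfolding left(4) subst.simps
      using t_ElimWith2.IH(1)[OF left(1) t_ElimWith2.prems(2,3) left(3)] left(2,5) t_ElimWith2.prems(2)
        typing_subst_undeclared[OF t_ElimWith2.hyps(2), of "Suc k" "lift 0 s"]
      by (auto intro!: typing.t_ElimWith2 del: equalityI)
  next
    case right
    show ?thesis
      unfolding right(4) subst.simps
      using typing_subst_undeclared[OF t_ElimWith2.hyps(1) right(1) t_ElimWith2.prems(2), of s] right(2,3,5) t_ElimWith2.prems(2,3)
        t_ElimWith2.IH(2)[of "Suc k" D "skip \<Theta>" "lift 0 s"]
      by (auto simp: typing_lift_binder simp del: map_add_assoc intro!: typing.t_ElimWith2 del: equalityI)
  qed
next
  case (t_ElimPlus \<Xi> \<Gamma> t A B \<Delta> u C v)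
  show ?case
    using t_ElimPlus.hyps(4) t_ElimPlus.prems(1,4)
  proof (cases rule: ctxt_del_add_cases)
    case left
    show ?thesis
      unfolding left(4) subst.simps
      using t_ElimPlus.IH(1)[OF left(1) t_ElimPlus.prems(2,3) left(3)] left(2,5) t_ElimPlus.prems(2)
        typing_subst_undeclared[OF t_ElimPlus.hyps(2), of "Suc k" "lift 0 s"]
        typing_subst_undeclared[OF t_ElimPlus.hyps(3), of "Suc k" "lift 0 s"]
      by (auto intro!: typing.t_ElimPlus del: equalityI)
  next
    case right
    show ?thesis
      unfolding right(4) subst.simps
      using typing_subst_undeclared[OF t_ElimPlus.hyps(1) right(1) t_ElimPlus.prems(2), of s] right(2,3,5) t_ElimPlus.prems(2,3)
        \<comment> \<open>Both branches share \<open>\<Delta>\<close>, so each receives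
          \<open>s\<close> together with \<open>\<Theta>\<close>.\<close>
        t_ElimPlus.IH(2,3)[of "Suc k" D "skip \<Theta>" "lift 0 s"]
      by (auto simp: typing_lift_binder simp del: map_add_assoc intro!: typing.t_ElimPlus del: equalityI)
  qed
next
  case (t_ElimBang \<Xi> \<Gamma> t A \<Delta> u B)
  show ?case
    using t_ElimBang.hyps(3) t_ElimBang.prems(1,4)
  proof (cases rule: ctxt_del_add_cases)
    case left
    show ?thesis
      unfolding left(4) subst.simps
      using t_ElimBang.IH(1)[OF left(1) t_ElimBang.prems(2,3) left(3)] left(2,5) t_ElimBang.prems(2)
        typing_subst_undeclared[OF t_ElimBang.hyps(2), of "Suc k" "lift 0 s"]
      by (auto intro!: typing.t_ElimBang del: equalityI)
  next
    case right
    show ?thesis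
      unfolding right(4) subst.simps
      using typing_subst_undeclared[OF t_ElimBang.hyps(1) right(1) t_ElimBang.prems(2), of s] right(2,3,5) t_ElimBang.prems(2,3)
        t_ElimBang.IH(2)[of "Suc k" D "skip \<Theta>" "lift 0 s"]
      by (auto simp: typing_lift_binder simp del: map_add_assoc intro!: typing.t_ElimBang del: equalityI)
  qed
\<comment> \<open>For \<open>t_Var\<close>, \<open>t_Star\<close> and \<open>t_Bang\<close> the
  linear context is empty and cannot declare \<open>k\<close>; the remaining rules have no
  split.\<close>
qed (auto intro!: typing.intros)

section \<open>Inversion, contraction of redexes, and induction on reduction\<close>

section \<open>Subject reduction\<close>

text \<open>Each of these term formers belongs to exactly one typing rule, so inversion returns its
  premises.\<close>

inductive_cases typing_elims:
  "\<Xi> \<Zsemi> \<Gamma> \<turnstile> t \<boxplus> u \<Colon> A"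
  "\<Xi> \<Zsemi> \<Gamma> \<turnstile> a \<bullet> t \<Colon> A"
  "\<Xi> \<Zsemi> \<Gamma> \<turnstile> Star a \<Colon> A"
  "\<Xi> \<Zsemi> \<Gamma> \<turnstile> ElimOne t u \<Colon> A"
  "\<Xi> \<Zsemi> \<Gamma> \<turnstile> Lam B t \<Colon> A"
  "\<Xi> \<Zsemi> \<Gamma> \<turnstile> App t u \<Colon> A"
  "\<Xi> \<Zsemi> \<Gamma> \<turnstile> Tens t u \<Colon> A"
  "\<Xi> \<Zsemi> \<Gamma> \<turnstile> ElimTensor t B C u \<Colon> A"
  "\<Xi> \<Zsemi> \<Gamma> \<turnstile> Unit \<Colon> A"
  "\<Xi> \<Zsemi> \<Gamma> \<turnstile> ElimZero t \<Colon> A"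
  "\<Xi> \<Zsemi> \<Gamma> \<turnstile> Pair t u \<Colon> A"
  "\<Xi> \<Zsemi> \<Gamma> \<turnstile> ElimWith1 t B u \<Colon> A"
  "\<Xi> \<Zsemi> \<Gamma> \<turnstile> ElimWith2 t B u \<Colon> A"
  "\<Xi> \<Zsemi> \<Gamma> \<turnstile> Inl t \<Colon> A"
  "\<Xi> \<Zsemi> \<Gamma> \<turnstile> Inr t \<Colon> A"
  "\<Xi> \<Zsemi> \<Gamma> \<turnstile> ElimPlus t B u C v \<Colon> A"
  "\<Xi> \<Zsemi> \<Gamma> \<turnstile> Bang t \<Colon> A"
  "\<Xi> \<Zsemi> \<Gamma> \<turnstile> ElimBang t B u \<Colon> A"
  "\<Xi> \<Zsemi> \<Gamma> \<turnstile> TLam t \<Colon> A"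
  "\<Xi> \<Zsemi> \<Gamma> \<turnstile> TApp t B \<Colon> A"

text \<open>The context of \<open>s\<close> is put first, where the elimination rules have that of
  the eliminated term; disjointness allows the swap.\<close>

lemma typing_beta_linear:
  assumes "skip \<Xi> \<Zsemi> decl B \<Delta> \<turnstile> t \<Colon> A" "\<Xi> \<Zsemi> \<Gamma> \<turnstile> s \<Colon> B" "dom \<Gamma> \<inter> dom \<Delta> = {}"
  shows "\<Xi> \<Zsemi> \<Gamma> ++ \<Delta> \<turnstile> subst 0 s t \<Colon> A"
  using typing_subst_linear[OF assms(1), of 0 B \<Gamma> s] assms(2,3) map_add_comm[OF assms(3)]
  by (simp add: Int_commute)

lemma typing_beta_unrestricted:
  assumes "decl B \<Xi> \<Zsemi> skip \<Gamma> \<turnstile> t \<Colon> A" "\<Xi> \<Zsemi> Map.empty \<turnstile> s \<Colon> B"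
  shows "\<Xi> \<Zsemi> \<Gamma> \<turnstile> subst 0 s t \<Colon> A"
  using typing_subst_unrestricted[OF assms(1), of 0 s] assms(2) by simp

text \<open>Two linear contractions: first \<open>v\<close> for the inner variable, lifted because
  the outer one is still bound, then \<open>u\<close>.\<close>

lemma typing_beta_tensor:
  assumes "\<Xi> \<Zsemi> \<Gamma> \<turnstile> u \<Colon> A" "\<Xi> \<Zsemi> \<Delta> \<turnstile> v \<Colon> B"
    and "skip (skip \<Xi>) \<Zsemi> decl B (decl A \<Theta>) \<turnstile> w \<Colon> C"
    and "dom \<Gamma> \<inter> dom \<Delta> = {}" "dom (\<Gamma> ++ \<Delta>) \<inter> dom \<Theta> = {}"
  shows "\<Xi> \<Zsemi> \<Gamma> ++ \<Delta> ++ \<Theta> \<turnstile> subst 0 u (subst 0 (lift 0 v) w) \<Colon> C"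
proof -
  have disj: "dom \<Delta> \<inter> dom \<Theta> = {}" "dom \<Gamma> \<inter> dom (\<Delta> ++ \<Theta>) = {}"
    using assms(4,5) by auto
  \<comment> \<open>Adding the context of the lifted \<open>v\<close> leaves index 0 declared for
    the second contraction.\<close>
  have "skip \<Delta> ++ decl A \<Theta> = decl A (\<Delta> ++ \<Theta>)"
    by (auto simp: fun_eq_iff decl_def skip_def map_add_def split: nat.splits)
  then have "skip \<Xi> \<Zsemi> decl A (\<Delta> ++ \<Theta>) \<turnstile> subst 0 (lift 0 v) w \<Colon> C"
    using typing_beta_linear[OF assms(3) typing_lift_binder(1)[OF assms(2)]] disj(1)
    by (simp add: Int_commute)
  from typing_beta_linear[OF this assms(1) disj(2)] show ?thesis
    by simp
qed

text \<open>The lifted contexts do not mention the bound variable, so substituting for it restores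
  them, by \<open>psubst_plift\<close>.\<close>

lemma typing_beta_type:
  assumes "ctxt_plift \<Xi> \<Zsemi> ctxt_plift \<Gamma> \<turnstile> t \<Colon> A"
  shows "\<Xi> \<Zsemi> \<Gamma> \<turnstile> tsubst 0 C t \<Colon> psubst 0 C A"
  using typing_tsubst[OF assms, of 0 C] by (simp add: ctxt_plift_eq ctxt_map_ctxt_map comp_def)

theorem theorem1:
  fixes \<Xi> \<Gamma> :: ctxt
    and t u :: "'s::{semiring_0,monoid_mult} trm"
    and A :: lprop
  assumes "\<Xi> \<Zsemi> \<Gamma> \<turnstile> t \<Colon> A"
    and "t \<leadsto> u"
  shows "\<Xi> \<Zsemi> \<Gamma> \<turnstile> u \<Colon> A"
  using assms(2,1)
\<comment> \<open>Contexts and type are generalized because congruence rules descend into premises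
  where these differ.\<close>
proof (induction arbitrary: \<Xi> \<Gamma> A rule: step.induct)
  case (r_Forall t B)
  then show ?case
    by (auto elim!: typing_elims intro: typing_beta_type)
next
  case (r_Tensor u v B C w)
  then show ?case
    by (auto elim!: typing_elims intro: typing_beta_tensor del: equalityI)
next
  case (r_Lolli B t u)
  then show ?case
    \<comment> \<open>In \<open>t_App\<close> the context of the argument comes second, so the union
      is commuted first.\<close>
    by (elim typing_elims) (auto, metis Int_commute map_add_comm typing_beta_linear)
next
  case (r_Bang t B u)
  \<comment> \<open>Inversion of \<open>Bang\<close> forces its linear context to be empty, as
    substitution for a non-linear variable requires.\<close>
  then show ?case
    by (auto elim!: typing_elims intro: typing_beta_unrestricted)
\<comment> \<open>The commuting rules rebuild a derivation from the same premises, since both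
  summands share their contexts.\<close>
qed (auto elim!: typing_elims intro: typing.intros typing_beta_linear del: equalityI)

end
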